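(* Let $A$ be a pseudo-valuation domain such that $2$ is a unit in $A$ and every strict unit of $A$ admits a square root, and fix a pseudo-angular component map $\mathbf{p.an}:K^\times\to F^\times$. Let $\mathfrak S_{F_0}^F$ be the set of families $(M_g)_{g\in G_{\geq e}}\in\prod_{g\in G_{\geq e}}\mathfrak X_{F_0}^F$ such that (i) $M_e\subseteq F_0$; (ii) $\operatorname{cl}_F(M_g)\subseteq M_h$ whenever $g,h\in G$, $e\leq g<h$ and $\overline g=\overline h$; (iii) $M_h=F$ whenever there exist $g\in G_{\geq e}$ and $u\in F\setminus\{0\}$ with $e\leq g<h$, $u\in M_g$ and $-u\in M_g$. Define the map $\sigma:\mathfrak X_A\to\mathfrak S_{F_0}^F$ by $\sigma(\mathcal M)=(M_g(\mathcal M))_{g\in G_{\geq e}}$. Then $\sigma$ is a bijection (in particular, it is well defined).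
   Context: A domain $A$ with quotient field $K$ is a pseudo-valuation domain if every prime ideal $\mathfrak p$ of $A$ is strongly prime, i.e. $x,y\in K$ and $xy\in\mathfrak p$ imply $x\in\mathfrak p$ or $y\in\mathfrak p$. Such $A$ is local; $\mathfrak m$ is its maximal ideal, $F_0=A/\mathfrak m$, and $\pi_0:A\to F_0$ is the residue map. It is known that there is a unique overring $B$ of $A$ ($A\subseteq B\subseteq K$) which is a valuation ring in $K$ with maximal ideal $\mathfrak m$. Let $\operatorname{val}:K^\times\to G$ be the (surjective) valuation with valuation ring $B$, where $(G,\leq)$ is a linearly ordered abelian group written multiplicatively with identity $e$, $\operatorname{val}(x+y)\geq\min(\operatorname{val}(x),\operatorname{val}(y))$, $\operatorname{val}(0)=\infty$, $B=\{x:\operatorname{val}(x)\geq e\}$, $\mathfrak m=\{x:\operatorname{val}(x)>e\}$. Let $F=B/\mathfrak m$ and $\pi:B\to F$ the residue map; $F_0$ is a subfield of $F$ and $\pi_0=\pi|_A$. $G_{\geq e}=\{g\in G: g\geq e\}$; $\overline g$ is the class of $g$ in $G/G^2$, $G^2$ being the set of squares in $G$. An element $x\in A$ is a strict unit if $\pi_0(x)=1$; it admits a square root if $x=u^2$ for some $u\in A$. A pseudo-angular component map is a map $\mathbf{p.an}:K^\times\to F^\times$ such that: (1) $\mathbf{p.an}(u)=\pi(u)$ for $u\in B^\times$; (2) $\mathbf{p.an}(ux)=\pi(u)\,\mathbf{p.an}(x)$ for $u\in B^\times$, $x\in K^\times$; (3) for any $g\in G$ and nonzero $c\in F$ there is $w\in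 K$ with $\operatorname{val}(w)=g$, $\mathbf{p.an}(w)=c$; (4) for nonzero $x_1,x_2\in K$ with $x_1+x_2\neq0$: $\mathbf{p.an}(x_1+x_2)=\mathbf{p.an}(x_1)$ if $\operatorname{val}(x_1)<\operatorname{val}(x_2)$; and $\operatorname{val}(x_1+x_2)=\operatorname{val}(x_1)$, $\mathbf{p.an}(x_1+x_2)=\mathbf{p.an}(x_1)+\mathbf{p.an}(x_2)$ if $\operatorname{val}(x_1)=\operatorname{val}(x_2)$ and $\mathbf{p.an}(x_1)+\mathbf{p.an}(x_2)\neq0$; (5) for $x,y\in K^\times$ with $\overline{\operatorname{val}(x)}=\overline{\operatorname{val}(y)}$ and $\mathbf{p.an}(x)=\mathbf{p.an}(y)$ there is $u\in K^\times$ with $y=u^2x$; (6) for $a,u\in K^\times$ there is $k\in F^\times$ with $\mathbf{p.an}(au^2)=\mathbf{p.an}(a)k^2$. Such a map is known to exist when all strict units of $A$ admit a square root. For a commutative ring $R$ and an $R$-module $N$, a quasi-quadratic $R$-module in $N$ is a subset $M\subseteq N$ with $M+M\subseteq M$ and $a^2M\subseteq M$ for all $a\in R$; by convention always $0\in M$ (the empty set is excluded). $\mathfrak X_R^N$ is the set of these, and $\mathfrak X_R=\mathfrak X_R^R$. For $M\subseteq F$, $\operatorname{cl}_F(M)$ is the smallest quasi-quadratic $F$-module in $F$ containing $M$, i.e. the set of finite sums $\sum a_i^2s_i$ with $a_i\in F$, $s_i\in M$. For $g\in G_{\geq e}$ and $\mathcal M\subseteq A$, $M_g(\mathcal M)=\{\mathbf{p.an}(x):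 x\in\mathcal M\setminus\{0\},\ \operatorname{val}(x)=g\}\cup\{0\}\subseteq F$. *)

theory Defs
  imports "HOL-Algebra.Algebra" "HOL-Library.FuncSet" "HOL.Hull"
begin

abbreviation subring_of :: "('a, 'b) ring_scheme \<Rightarrow> 'a set \<Rightarrow> ('a, 'b) ring_scheme" where
  "subring_of K A \<equiv> K\<lparr>carrier := A\<rparr>"

abbreviation nonzero :: "('a, 'b) ring_scheme \<Rightarrow> 'a set" where
  "nonzero R \<equiv> carrier R - {\<zero>\<^bsub>R\<^esub>}"

definition quotient_field_of :: "('a, 'b) ring_scheme \<Rightarrow> 'a set \<Rightarrow> bool" where
  "quotient_field_of K A \<longleftrightarrow>
     field K \<and> subdomain A K \<and>
     (\<forall>x\<in>carrier K. \<exists>a\<in>A. \<exists>b\<in>A - {\<zero>\<^bsub>K\<^esub>}. x = a \<otimes>\<^bsub>K\<^esub> inv\<^bsub>K\<^esub> b)"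

definition strongly_prime :: "('a, 'b) ring_scheme \<Rightarrow> 'a set \<Rightarrow> bool" where
  "strongly_prime K P \<longleftrightarrow>
     (\<forall>x\<in>carrier K. \<forall>y\<in>carrier K. x \<otimes>\<^bsub>K\<^esub> y \<in> P \<longrightarrow> x \<in> P \<or> y \<in> P)"

definition pseudo_valuation_domain :: "('a, 'b) ring_scheme \<Rightarrow> 'a set \<Rightarrow> bool" where
  "pseudo_valuation_domain K A \<longleftrightarrow>
     quotient_field_of K A \<and> (\<forall>P. primeideal P (subring_of K A) \<longrightarrow> strongly_prime K P)"

definition valuation_ring_in :: "('a, 'b) ring_scheme \<Rightarrow> 'a set \<Rightarrow> bool" where
  "valuation_ring_in K B \<longleftrightarrow>
     field K \<and> subring B K \<and> (\<forall>x\<in>nonzero K. x \<in> B \<or> inv\<^bsub>K\<^esub> x \<in> B)"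

text \<open>The value group is written additively, so that its identity is \<open>0\<close> and \<open>G\<^sup>2\<close> is the set of
  all \<open>k + k\<close>. A valuation is constrained on nonzero elements only; instead of giving the zero
  of \<open>K\<close> the value \<open>\<infinity>\<close>, the conditions treat it separately.\<close>

definition surj_valuation :: "('a, 'b) ring_scheme \<Rightarrow> ('a \<Rightarrow> 'g::linordered_ab_group_add) \<Rightarrow> bool" where
  "surj_valuation K val \<longleftrightarrow>
     val ` nonzero K = UNIV \<and>
     (\<forall>x\<in>nonzero K. \<forall>y\<in>nonzero K. val (x \<otimes>\<^bsub>K\<^esub> y) = val x + val y) \<and>
     (\<forall>x\<in>nonzero K. \<forall>y\<in>nonzero K.
        x \<oplus>\<^bsub>K\<^esub> y \<noteq> \<zero>\<^bsub>K\<^esub> \<longrightarrow> min (val x) (val y) \<le> val (x \<oplus>\<^bsub>K\<^esub> y))"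

definition ring_of_valuation ::
    "('a, 'b) ring_scheme \<Rightarrow> ('a \<Rightarrow> 'g::linordered_ab_group_add) \<Rightarrow> 'a set" where
  "ring_of_valuation K val = {x \<in> carrier K. x = \<zero>\<^bsub>K\<^esub> \<or> 0 \<le> val x}"

definition square_class :: "'g::linordered_ab_group_add \<Rightarrow> 'g set" where
  "square_class g = {g + (k + k) | k. True}"

text \<open>When an ideal \<open>I\<close> of \<open>B\<close> is contained in a subring \<open>A\<close> of \<open>B\<close>, the \<open>I\<close>-coset of an element
  of \<open>A\<close> is the same set whether formed in \<open>A\<close> or in \<open>B\<close>. So the carrier of
  \<open>residue_ring K A I\<close> is literally a subset of that of \<open>residue_ring K B I\<close>, with the same
  operations, and \<open>residue_map K A I\<close> is the restriction of \<open>residue_map K B I\<close>.\<close>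

definition residue_ring :: "('a, 'b) ring_scheme \<Rightarrow> 'a set \<Rightarrow> 'a set \<Rightarrow> 'a set ring" where
  "residue_ring K B I = subring_of K B Quot I"

definition residue_map :: "('a, 'b) ring_scheme \<Rightarrow> 'a set \<Rightarrow> 'a set \<Rightarrow> 'a \<Rightarrow> 'a set" where
  "residue_map K B I x = I +>\<^bsub>subring_of K B\<^esub> x"

definition strict_unit :: "('a, 'b) ring_scheme \<Rightarrow> 'a set \<Rightarrow> 'a set \<Rightarrow> 'a \<Rightarrow> bool" where
  "strict_unit K A I x \<longleftrightarrow> x \<in> A \<and> residue_map K A I x = \<one>\<^bsub>residue_ring K A I\<^esub>"

definition admits_square_root :: "('a, 'b) ring_scheme \<Rightarrow> 'a set \<Rightarrow> 'a \<Rightarrow> bool" where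
  "admits_square_root K A x \<longleftrightarrow> (\<exists>u\<in>A. x = u \<otimes>\<^bsub>K\<^esub> u)"

definition pseudo_angular_component ::
    "('a, 'b) ring_scheme \<Rightarrow> 'a set \<Rightarrow> 'a set \<Rightarrow> ('a \<Rightarrow> 'g::linordered_ab_group_add)
      \<Rightarrow> ('a \<Rightarrow> 'a set) \<Rightarrow> bool" where
  "pseudo_angular_component K B I val pan \<longleftrightarrow>
    (let F = residue_ring K B I; \<pi> = residue_map K B I in
      pan \<in> nonzero K \<rightarrow> nonzero F \<and>
      (\<forall>u\<in>Units (subring_of K B). pan u = \<pi> u) \<and>
      (\<forall>u\<in>Units (subring_of K B). \<forall>x\<in>nonzero K. pan (u \<otimes>\<^bsub>K\<^esub> x) = \<pi> u \<otimes>\<^bsub>F\<^esub> pan x) \<and>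
      (\<forall>g. \<forall>c\<in>nonzero F. \<exists>w\<in>nonzero K. val w = g \<and> pan w = c) \<and>
      (\<forall>x\<^sub>1\<in>nonzero K. \<forall>x\<^sub>2\<in>nonzero K. x\<^sub>1 \<oplus>\<^bsub>K\<^esub> x\<^sub>2 \<noteq> \<zero>\<^bsub>K\<^esub> \<longrightarrow>
         (val x\<^sub>1 < val x\<^sub>2 \<longrightarrow> pan (x\<^sub>1 \<oplus>\<^bsub>K\<^esub> x\<^sub>2) = pan x\<^sub>1) \<and>
         (val x\<^sub>1 = val x\<^sub>2 \<and> pan x\<^sub>1 \<oplus>\<^bsub>F\<^esub> pan x\<^sub>2 \<noteq> \<zero>\<^bsub>F\<^esub> \<longrightarrow>
            val (x\<^sub>1 \<oplus>\<^bsub>K\<^esub> x\<^sub>2) = val x\<^sub>1 \<and> pan (x\<^sub>1 \<oplus>\<^bsub>K\<^esub> x\<^sub>2) = pan x\<^sub>1 \<oplus>\<^bsub>F\<^esub> pan x\<^sub>2)) \<and>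
      (\<forall>x\<in>nonzero K. \<forall>y\<in>nonzero K.
         square_class (val x) = square_class (val y) \<and> pan x = pan y \<longrightarrow>
         (\<exists>u\<in>nonzero K. y = u \<otimes>\<^bsub>K\<^esub> u \<otimes>\<^bsub>K\<^esub> x)) \<and>
      (\<forall>a\<in>nonzero K. \<forall>u\<in>nonzero K. \<exists>k\<in>nonzero F.
         pan (a \<otimes>\<^bsub>K\<^esub> (u \<otimes>\<^bsub>K\<^esub> u)) = pan a \<otimes>\<^bsub>F\<^esub> (k \<otimes>\<^bsub>F\<^esub> k)))"

definition quasi_quadratic_modules ::
    "('r, 'c) ring_scheme \<Rightarrow> ('r, 'n, 'd) module_scheme \<Rightarrow> 'n set set" where
  "quasi_quadratic_modules R N =
     {M. M \<subseteq> carrier N \<and> \<zero>\<^bsub>N\<^esub> \<in> M \<and>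
         (\<forall>x\<in>M. \<forall>y\<in>M. x \<oplus>\<^bsub>N\<^esub> y \<in> M) \<and>
         (\<forall>a\<in>carrier R. \<forall>x\<in>M. (a \<otimes>\<^bsub>R\<^esub> a) \<odot>\<^bsub>N\<^esub> x \<in> M)}"

text \<open>The ring \<open>R\<close> as a module over itself or over any of its subrings.\<close>

definition ring_as_module :: "('a, 'b) ring_scheme \<Rightarrow> ('a, 'a) module" where
  "ring_as_module R =
     \<lparr>carrier = carrier R, monoid.mult = (\<otimes>\<^bsub>R\<^esub>), one = \<one>\<^bsub>R\<^esub>, ring.zero = \<zero>\<^bsub>R\<^esub>,
      add = (\<oplus>\<^bsub>R\<^esub>), smult = (\<otimes>\<^bsub>R\<^esub>)\<rparr>"

definition qq_closure :: "('a, 'b) ring_scheme \<Rightarrow> 'a set \<Rightarrow> 'a set" where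
  "qq_closure F M = (\<lambda>N. N \<in> quasi_quadratic_modules F (ring_as_module F)) hull M"

definition value_component ::
    "('a, 'b) ring_scheme \<Rightarrow> 'a set \<Rightarrow> 'a set \<Rightarrow> ('a \<Rightarrow> 'g::linordered_ab_group_add)
      \<Rightarrow> ('a \<Rightarrow> 'a set) \<Rightarrow> 'g \<Rightarrow> 'a set \<Rightarrow> 'a set set" where
  "value_component K B I val pan g M =
     {pan x | x. x \<in> M - {\<zero>\<^bsub>K\<^esub>} \<and> val x = g} \<union> {\<zero>\<^bsub>residue_ring K B I\<^esub>}"

text \<open>The set of families called \<open>\<SS>\<close> with subscript \<open>F\<^sub>0\<close> and superscript \<open>F\<close>. A family indexed by
  the nonnegative values is a function that is \<open>undefined\<close> at negative values.\<close>

definition qq_families ::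
    "('f, 'b) ring_scheme \<Rightarrow> ('f, 'c) ring_scheme \<Rightarrow> ('g::linordered_ab_group_add \<Rightarrow> 'f set) set" where
  "qq_families F\<^sub>0 F =
     {M \<in> {0..} \<rightarrow>\<^sub>E quasi_quadratic_modules F\<^sub>0 (ring_as_module F).
        M 0 \<subseteq> carrier F\<^sub>0 \<and>
        (\<forall>g h. 0 \<le> g \<and> g < h \<and> square_class g = square_class h \<longrightarrow> qq_closure F (M g) \<subseteq> M h) \<and>
        (\<forall>h. (\<exists>g u. 0 \<le> g \<and> g < h \<and> u \<in> nonzero F \<and> u \<in> M g \<and> \<ominus>\<^bsub>F\<^esub> u \<in> M g)
               \<longrightarrow> M h = carrier F)}"

definition component_family ::
    "('a, 'b) ring_scheme \<Rightarrow> 'a set \<Rightarrow> 'a set \<Rightarrow> ('a \<Rightarrow> 'g::linordered_ab_group_add)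
      \<Rightarrow> ('a \<Rightarrow> 'a set) \<Rightarrow> 'a set \<Rightarrow> 'g \<Rightarrow> 'a set set" where
  "component_family K B I val pan M = (\<lambda>g\<in>{0..}. value_component K B I val pan g M)"

end

theory Submission
  imports Defs
begin

text \<open>Two elements of \<open>K\<close> with the same value and the same pseudo-angular component differ by a
  strict unit, hence by the square of an element of \<open>A\<close>. So a quasi-quadratic module in \<open>A\<close>
  contains a nonzero \<open>x\<close> as soon as its component at \<open>val x\<close> contains \<open>pan x\<close>, and the inverse of
  \<open>\<sigma>\<close> sends a family \<open>N\<close> to the set of all \<open>x\<close> with \<open>pan x \<in> N (val x)\<close>. The conditions on families
  reflect that elements of positive value lie in \<open>A\<close>: multiplication by their squares gives
  condition (ii). If \<open>x\<close> and \<open>-x\<close> both lie in the module, then so does \<open>z x\<close> for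
  \<open>z = ((z + 1) / 2)\<^sup>2 - ((z - 1) / 2)\<^sup>2\<close> in \<open>A\<close>, which gives condition (iii). Conversely, (iii) handles
  sums in which the leading components cancel.\<close>

section \<open>Square classes in the ordered value group\<close>

lemma square_class_eq_obtains:
  assumes "square_class g = square_class (h :: 'g::linordered_ab_group_add)" "g < h"
  obtains k where "h = g + (k + k)" "0 < k"
proof -
  have "h \<in> square_class h"
    unfolding square_class_def by (rule CollectI, rule exI[of _ 0]) simp
  then have "h \<in> square_class g"
    using assms by simp
  then obtain k where k: "h = g + (k + k)"
    by (auto simp: square_class_def)
  \<comment> \<open>In a linearly ordered group \<open>0 < k + k\<close> forces
    \<open>0 < k\<close>. Positivity will put elements of value \<open>k\<close> into
    \<open>A\<close>.\<close>
  with assms that show ?thesis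
    by simp
qed

lemma square_class_add_double: "square_class (g + (k + k)) = square_class (g :: 'g::linordered_ab_group_add)"
proof (intro equalityI subsetI)
  fix x assume "x \<in> square_class (g + (k + k))"
  then obtain l where "x = g + (k + k) + (l + l)"
    by (auto simp: square_class_def)
  then have "x = g + ((k + l) + (k + l))"
    by (simp add: algebra_simps)
  then show "x \<in> square_class g"
    unfolding square_class_def by blast
next
  fix x assume "x \<in> square_class g"
  then obtain l where "x = g + (l + l)"
    by (auto simp: square_class_def)
  then have "x = g + (k + k) + ((l - k) + (l - k))"
    by (simp add: algebra_simps)
  then show "x \<in> square_class (g + (k + k))"
    unfolding square_class_def by blast
qed

section \<open>The setting: the field, its two subrings and the residue field\<close>

locale valued_pvd =
  fixes K :: "('a, 'b) ring_scheme" (structure)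
    and A B \<mm> :: "'a set"
    and val :: "'a \<Rightarrow> 'g::linordered_ab_group_add"
    and pan :: "'a \<Rightarrow> 'a set"
  assumes pvd: "pseudo_valuation_domain K A"
    and maximal_A: "maximalideal \<mm> (subring_of K A)"
    and valuation_ring: "valuation_ring_in K B"
    and A_subset_B: "A \<subseteq> B"
    and maximal_B: "maximalideal \<mm> (subring_of K B)"
    and surj_val: "surj_valuation K val"
    and B_eq: "B = ring_of_valuation K val"
    and two_unit: "\<one> \<oplus> \<one> \<in> Units (subring_of K A)"
    and strict_unit_square: "\<And>x. strict_unit K A \<mm> x \<Longrightarrow> admits_square_root K A x"
    and pan: "pseudo_angular_component K B \<mm> val pan"
begin

abbreviation F :: "'a set ring" where "F \<equiv> residue_ring K B \<mm>"
abbreviation F\<^sub>0 :: "'a set ring" where "F\<^sub>0 \<equiv> residue_ring K A \<mm>"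
abbreviation res :: "'a \<Rightarrow> 'a set" where "res \<equiv> residue_map K B \<mm>"

lemma field_K: "field K"
  using valuation_ring by (simp add: valuation_ring_in_def)

end

sublocale valued_pvd \<subseteq> field K
  by (rule field_K)

context valued_pvd
begin

lemma subring_B: "subring B K"
  using valuation_ring by (simp add: valuation_ring_in_def)

lemma subring_A: "subring A K"
  using pvd subdomain.axioms(1) subcring.axioms(1)
  by (auto simp: pseudo_valuation_domain_def quotient_field_of_def)

lemma cring_B: "cring (subring_of K B)"
  using subcring_iff[OF subringE(1)[OF subring_B]] subcringI'[OF subring_B] by blast

lemma field_F: "field F"
  unfolding residue_ring_def
  by (rule maximalideal.quotient_is_field[OF maximal_B cring_B])

lemma ideal_B: "ideal \<mm> (subring_of K B)"
  using maximal_B maximalideal.axioms(1) by blast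

lemma ideal_A: "ideal \<mm> (subring_of K A)"
  using maximal_A maximalideal.axioms(1) by blast

end

sublocale valued_pvd \<subseteq> F: field "residue_ring K B \<mm>"
  by (rule field_F)

context valued_pvd
begin

section \<open>Values, units of B and the maximal ideal\<close>

lemma B_iff: "x \<in> B \<longleftrightarrow> x \<in> carrier K \<and> (x = \<zero> \<or> 0 \<le> val x)"
  by (auto simp: B_eq ring_of_valuation_def)

lemma A_carrier: "x \<in> A \<Longrightarrow> x \<in> carrier K"
  using subringE(1)[OF subring_A] by blast

lemma nonzero_mult: "x \<in> nonzero K \<Longrightarrow> y \<in> nonzero K \<Longrightarrow> x \<otimes> y \<in> nonzero K"
  using integral by auto

lemma nonzero_inv: "x \<in> nonzero K \<Longrightarrow> inv x \<in> nonzero K"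
  using field_Units by blast

lemma val_mult: "x \<in> nonzero K \<Longrightarrow> y \<in> nonzero K \<Longrightarrow> val (x \<otimes> y) = val x + val y"
  using surj_val by (simp add: surj_valuation_def)

lemma val_add:
  "x \<in> nonzero K \<Longrightarrow> y \<in> nonzero K \<Longrightarrow> x \<oplus> y \<noteq> \<zero> \<Longrightarrow> min (val x) (val y) \<le> val (x \<oplus> y)"
  using surj_val unfolding surj_valuation_def by blast

lemma val_one: "val \<one> = 0"
  using val_mult[of \<one> \<one>] by simp

lemma val_inv:
  assumes "x \<in> nonzero K" shows "val (inv x) = - val x"
proof -
  have "x \<otimes> inv x = \<one>"
    using assms field_Units by auto
  then show ?thesis
    using val_mult[OF assms nonzero_inv[OF assms]] val_one by (simp add: eq_neg_iff_add_eq_0 add.commute)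
qed

text \<open>The square of \<open>\<ominus> \<one>\<close> is one, and a linearly ordered group has
  no element of order two, so \<open>\<ominus> \<one>\<close> has value 0.\<close>

lemma val_minus:
  assumes "x \<in> nonzero K" shows "val (\<ominus> x) = val x"
proof -
  have one: "\<ominus> \<one> \<in> nonzero K"
    using add.inv_eq_1_iff by auto
  have "val (\<ominus> \<one>) + val (\<ominus> \<one>) = 0"
    using val_mult[OF one one] val_one by (simp add: l_minus)
  then have "val (\<ominus> \<one>) = 0"
    by simp
  then show ?thesis
    using val_mult[OF one assms] assms by (simp add: l_minus)
qed

lemma nonzero_minus: "x \<in> nonzero K \<Longrightarrow> \<ominus> x \<in> nonzero K"
  using add.inv_eq_1_iff by auto

text \<open>The ultrametric inequality for \<open>x \<oplus> y\<close> gives one bound. Applied to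
  \<open>x = (x \<oplus> y) \<oplus> \<ominus> y\<close> it gives the other, because
  \<open>val y\<close> is too large to be the minimum. The sum cannot vanish, since \<open>x\<close>
  and \<open>\<ominus> y\<close> have different values.\<close>

lemma val_add_less:
  assumes "x \<in> nonzero K" "y \<in> nonzero K" "val x < val y"
  shows "x \<oplus> y \<in> nonzero K \<and> val (x \<oplus> y) = val x"
proof -
  have x: "x = (x \<oplus> y) \<oplus> \<ominus> y"
    using assms by (simp add: a_assoc r_neg)
  have ne: "x \<oplus> y \<noteq> \<zero>"
  proof
    assume "x \<oplus> y = \<zero>"
    then have "x = \<ominus> y"
      using x assms by simp
    then show False
      using assms val_minus[OF assms(2)] by simp
  qed
  then have xy: "x \<oplus> y \<in> nonzero K"
    using assms by simp
  have "min (val (x \<oplus> y)) (val y) \<le> val x"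
    using val_add[OF xy nonzero_minus[OF assms(2)]] x assms val_minus[OF assms(2)] by simp
  then show ?thesis
    using val_add[OF assms(1,2) ne] assms(3) xy by (simp add: min_def split: if_splits)
qed

lemma Units_B: "Units (subring_of K B) = {x \<in> nonzero K. val x = 0}"
proof (intro equalityI subsetI)
  fix x assume "x \<in> Units (subring_of K B)"
  then obtain y where xy: "x \<in> B" "y \<in> B" "x \<otimes> y = \<one>"
    by (auto simp: Units_def)
  then have nz: "x \<in> nonzero K" "y \<in> nonzero K"
    by (auto simp: B_iff)
  then have "val x + val y = 0" "0 \<le> val x" "0 \<le> val y"
    using val_mult[OF nz] xy val_one by (auto simp: B_iff)
  then show "x \<in> {x \<in> nonzero K. val x = 0}"
    using nz add_nonneg_eq_0_iff by auto
next
  fix x assume x: "x \<in> {x \<in> nonzero K. val x = 0}"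
  then have "x \<in> B" "inv x \<in> B"
    using nonzero_inv[of x] val_inv[of x] by (auto simp: B_iff)
  moreover have "x \<otimes> inv x = \<one>" "inv x \<otimes> x = \<one>"
    using x field_Units by auto
  ultimately show "x \<in> Units (subring_of K B)"
    by (auto simp: Units_def)
qed

text \<open>This ties the abstractly given ideal to the valuation. Elements of value 0 are units of
  \<open>B\<close>, so the maximal ideal lies in the set \<open>?P\<close> of zero and the elements
  of positive value. As \<open>?P\<close> is itself a proper ideal of \<open>B\<close>, maximality
  forces equality.\<close>

lemma maximal_ideal_iff: "x \<in> \<mm> \<longleftrightarrow> x \<in> carrier K \<and> (x = \<zero> \<or> 0 < val x)"
proof -
  let ?P = "{x \<in> carrier K. x = \<zero> \<or> 0 < val x}"
  interpret RB: cring "subring_of K B" by (rule cring_B)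
  interpret IB: ideal \<mm> "subring_of K B" by (rule ideal_B)
  have mB: "\<mm> \<subseteq> B"
    using IB.a_subset by simp
  have "\<mm> \<subseteq> ?P"
  proof
    fix x assume x: "x \<in> \<mm>"
    show "x \<in> ?P"
    proof (rule ccontr)
      assume "x \<notin> ?P"
      then have u: "x \<in> Units (subring_of K B)"
        using x mB by (force simp: Units_B B_iff)
      then have "\<mm> = B"
        using IB.I_l_closed[OF x RB.Units_inv_closed[OF u]] RB.Units_l_inv[OF u] IB.one_imp_carrier by simp
      then show False
        using maximalideal.I_notcarr[OF maximal_B] by simp
    qed
  qed
  moreover have "?P \<subseteq> B"
    by (auto simp: B_iff)
  moreover from calculation have "?P = \<mm> \<or> ?P = B"
  proof -
    assume "\<mm> \<subseteq> ?P" "?P \<subseteq> B"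
    have "ideal ?P (subring_of K B)"
    proof (rule idealI)
      show "ring (subring_of K B)" by (rule RB.ring_axioms)
      show "subgroup ?P (add_monoid (subring_of K B))"
      proof (rule RB.add.subgroupI)
        show "?P \<subseteq> carrier (subring_of K B)" by (auto simp: B_iff)
        show "?P \<noteq> {}" by auto
        fix a assume a: "a \<in> ?P"
        then have "a \<in> B" by (auto simp: B_iff)
        \<comment> \<open>Negation in the subring is defined relative to the smaller carrier, so it
          has to be identified with negation in \<open>K\<close> before values can be
          compared.\<close>
        have "\<ominus>\<^bsub>subring_of K B\<^esub> a = \<ominus> a"
          using a \<open>a \<in> B\<close> RB.minus_equality[of "\<ominus> a" a] subringE(5)[OF subring_B]
          by (simp add: l_neg)
        then show "\<ominus>\<^bsub>subring_of K B\<^esub> a \<in> ?P"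
          using a val_minus[of a] by (cases "a = \<zero>") auto
      next
        fix a b assume ab: "a \<in> ?P" "b \<in> ?P"
        have "0 < val (a \<oplus> b)" if "a \<noteq> \<zero>" "b \<noteq> \<zero>" "a \<oplus> b \<noteq> \<zero>"
          using val_add[of a b] that ab by (auto simp: min_def split: if_splits)
        then show "a \<oplus>\<^bsub>subring_of K B\<^esub> b \<in> ?P"
          using ab by (cases "a = \<zero>"; cases "b = \<zero>") auto
      qed
    next
      fix a x assume "a \<in> ?P" "x \<in> carrier (subring_of K B)"
      then have "a \<in> carrier K" "x \<in> carrier K" "a = \<zero> \<or> x = \<zero> \<or> a \<in> nonzero K \<and> x \<in> nonzero K \<and> 0 < val a + val x"
        by (auto simp: B_iff add_pos_nonneg)
      then have "x \<otimes> a \<in> ?P"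
        using val_mult[of x a] by (auto simp: add.commute)
      then show "x \<otimes>\<^bsub>subring_of K B\<^esub> a \<in> ?P" "a \<otimes>\<^bsub>subring_of K B\<^esub> x \<in> ?P"
        using \<open>a \<in> carrier K\<close> \<open>x \<in> carrier K\<close> by (simp_all add: m_comm)
    qed
    then show ?thesis
      using maximalideal.I_maximal[OF maximal_B, of ?P] \<open>\<mm> \<subseteq> ?P\<close> \<open>?P \<subseteq> B\<close>
      by auto
  qed
  \<comment> \<open>The unit element excludes the alternative \<open>?P = B\<close>.\<close>
  moreover have "\<one> \<in> B" "\<one> \<notin> ?P"
    using val_one by (auto simp: B_iff)
  ultimately show ?thesis
    by blast
qed

lemma maximal_ideal_subset_A: "\<mm> \<subseteq> A"
  using ideal.Icarr[OF ideal_A] by auto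

section \<open>The residue maps of A and B\<close>

lemma residue_map_A: "residue_map K A \<mm> = res"
  by (rule ext) (simp add: residue_map_def a_r_coset_def r_coset_def)

lemma carrier_F: "carrier F = res ` B"
  by (auto simp: residue_ring_def residue_map_def FactRing_def A_RCOSETS_def')

lemma carrier_F0: "carrier F\<^sub>0 = res ` A"
  unfolding residue_map_A[symmetric]
  by (auto simp: residue_ring_def residue_map_def FactRing_def A_RCOSETS_def')

lemma mult_F0: "x \<otimes>\<^bsub>F\<^sub>0\<^esub> y = x \<otimes>\<^bsub>F\<^esub> y"
  by (simp add: residue_ring_def FactRing_def rcoset_mult_def a_r_coset_def r_coset_def)

lemma one_F0: "\<one>\<^bsub>F\<^sub>0\<^esub> = \<one>\<^bsub>F\<^esub>"
  by (simp add: residue_ring_def FactRing_def a_r_coset_def r_coset_def)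

lemma res_hom: "ring_hom_ring (subring_of K B) F res"
  unfolding residue_ring_def residue_map_def
  using ideal.rcos_ring_hom_ring[OF ideal_B] by simp

lemma res_closed [simp]: "x \<in> B \<Longrightarrow> res x \<in> carrier F"
  by (simp add: carrier_F)

lemma res_one: "res \<one> = \<one>\<^bsub>F\<^esub>"
  by (simp add: residue_map_def residue_ring_def FactRing_def)

lemma res_mult: "x \<in> B \<Longrightarrow> y \<in> B \<Longrightarrow> res (x \<otimes> y) = res x \<otimes>\<^bsub>F\<^esub> res y"
  using ring_hom_mult[OF ring_hom_ring.homh[OF res_hom]] by simp

lemma res_add: "x \<in> B \<Longrightarrow> y \<in> B \<Longrightarrow> res (x \<oplus> y) = res x \<oplus>\<^bsub>F\<^esub> res y"
  using ring_hom_add[OF ring_hom_ring.homh[OF res_hom]] by simp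

lemma res_eq_zero:
  assumes "x \<in> B" shows "res x = \<zero>\<^bsub>F\<^esub> \<longleftrightarrow> x \<in> \<mm>"
  using assms ideal.rcos_const_imp_mem[OF ideal_B, of x] cring.axioms(1)[OF cring_B]
    ring.a_rcos_zero[of "subring_of K B" \<mm> x] ideal_B
  by (auto simp: residue_ring_def residue_map_def FactRing_def)

text \<open>\<open>A\<close> is the full preimage in \<open>B\<close> of its residue field: an
  element of \<open>B\<close> with the same residue as some \<open>a\<close> in \<open>A\<close>
  differs from \<open>a\<close> by an element of the maximal ideal, which is contained in
  \<open>A\<close>.\<close>

lemma mem_A_iff:
  assumes "x \<in> B" shows "x \<in> A \<longleftrightarrow> res x \<in> res ` A"
proof
  assume "res x \<in> res ` A"
  then obtain a where a: "a \<in> A" "res x = res a"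
    by blast
  have cl: "x \<in> carrier K" "a \<in> carrier K" "a \<in> B" "\<ominus> a \<in> B"
    using assms a A_subset_B A_carrier subringE(5)[OF subring_B] subringE(1)[OF subring_B] by blast+
  have "res (x \<oplus> \<ominus> a) = res a \<oplus>\<^bsub>F\<^esub> res (\<ominus> a)"
    using res_add assms cl a by simp
  also have "\<dots> = res (a \<oplus> \<ominus> a)"
    using res_add cl by simp
  also have "\<dots> = \<zero>\<^bsub>F\<^esub>"
    using cl res_eq_zero[of \<zero>] by (simp add: r_neg B_iff maximal_ideal_iff)
  finally have "x \<oplus> \<ominus> a \<in> A"
    using res_eq_zero subringE(7)[OF subring_B] assms cl maximal_ideal_subset_A by blast
  then have "(x \<oplus> \<ominus> a) \<oplus> a \<in> A"
    using a subringE(7)[OF subring_A] by blast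
  then show "x \<in> A"
    using cl by (simp add: a_assoc l_neg)
qed auto

lemma A_if_val_pos: "x \<in> nonzero K \<Longrightarrow> 0 < val x \<Longrightarrow> x \<in> A"
  using maximal_ideal_iff maximal_ideal_subset_A by blast

lemma val_nonneg: "x \<in> A \<Longrightarrow> x \<noteq> \<zero> \<Longrightarrow> 0 \<le> val x"
  using A_subset_B by (auto simp: B_iff)

lemma B_if_val_zero: "x \<in> nonzero K \<Longrightarrow> val x = 0 \<Longrightarrow> x \<in> B"
  by (simp add: B_iff)

section \<open>Consequences of the axioms for the pseudo-angular component\<close>

lemmas pan_unfolded = pan[unfolded pseudo_angular_component_def Let_def Units_B]

lemmas pan_props =
  pan_unfolded[THEN conjunct1]
  pan_unfolded[THEN conjunct2, THEN conjunct1]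
  pan_unfolded[THEN conjunct2, THEN conjunct2, THEN conjunct1]
  pan_unfolded[THEN conjunct2, THEN conjunct2, THEN conjunct2, THEN conjunct1]
  pan_unfolded[THEN conjunct2, THEN conjunct2, THEN conjunct2, THEN conjunct2, THEN conjunct1]
  pan_unfolded[THEN conjunct2, THEN conjunct2, THEN conjunct2, THEN conjunct2, THEN conjunct2, THEN conjunct2]

lemma pan_closed: "x \<in> nonzero K \<Longrightarrow> pan x \<in> nonzero F"
  using pan_props(1) by blast

lemma pan_unit: "u \<in> nonzero K \<Longrightarrow> val u = 0 \<Longrightarrow> pan u = res u"
  using pan_props(2) by blast

lemma pan_unit_mult:
  "u \<in> nonzero K \<Longrightarrow> val u = 0 \<Longrightarrow> x \<in> nonzero K \<Longrightarrow> pan (u \<otimes> x) = res u \<otimes>\<^bsub>F\<^esub> pan x"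
  using pan_props(3) by blast

lemma pan_surj:
  assumes "c \<in> nonzero F"
  obtains w where "w \<in> nonzero K" "val w = g" "pan w = c"
  using pan_props(4) assms by blast

lemma pan_add_less:
  "x \<in> nonzero K \<Longrightarrow> y \<in> nonzero K \<Longrightarrow> val x < val y \<Longrightarrow> pan (x \<oplus> y) = pan x"
  using pan_props(5) val_add_less[of x y] by blast

lemma pan_square:
  assumes "a \<in> nonzero K" "u \<in> nonzero K"
  obtains k where "k \<in> nonzero F" "pan (a \<otimes> (u \<otimes> u)) = pan a \<otimes>\<^bsub>F\<^esub> (k \<otimes>\<^bsub>F\<^esub> k)"
  using pan_props(6) assms by blast

lemma res_minus_one: "res (\<ominus> \<one>) = \<ominus>\<^bsub>F\<^esub> \<one>\<^bsub>F\<^esub>"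
proof -
  have B: "\<one> \<in> B" "\<ominus> \<one> \<in> B"
    using subringE(3,5)[OF subring_B] by auto
  have "res (\<ominus> \<one>) \<oplus>\<^bsub>F\<^esub> \<one>\<^bsub>F\<^esub> = res (\<ominus> \<one> \<oplus> \<one>)"
    using res_add B res_one by simp
  also have "\<dots> = \<zero>\<^bsub>F\<^esub>"
    using res_eq_zero[of \<zero>] by (simp add: l_neg B_iff maximal_ideal_iff)
  finally show ?thesis
    using F.minus_equality[of "res (\<ominus> \<one>)" "\<one>\<^bsub>F\<^esub>"] B by simp
qed

text \<open>Negation is multiplication by \<open>\<ominus> \<one>\<close>, a unit of
  \<open>B\<close> with residue minus one.\<close>

lemma pan_minus:
  assumes "x \<in> nonzero K" shows "pan (\<ominus> x) = \<ominus>\<^bsub>F\<^esub> pan x"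
proof -
  have one: "\<one> \<in> nonzero K"
    by simp
  have "pan (\<ominus> \<one> \<otimes> x) = res (\<ominus> \<one>) \<otimes>\<^bsub>F\<^esub> pan x"
    using pan_unit_mult[OF nonzero_minus[OF one] _ assms] val_minus[OF one] val_one by simp
  then show ?thesis
    using assms pan_closed[OF assms] by (simp add: l_minus F.l_minus res_minus_one)
qed

text \<open>The quotient \<open>q\<close> of \<open>y\<close> by \<open>x\<close> has value 0 and is
  thus a unit of \<open>B\<close>. Comparing two elements of equal value becomes a computation with
  the residue of \<open>q\<close>.\<close>

lemma quotient_of_equal_val:
  assumes "x \<in> nonzero K" "y \<in> nonzero K" "val x = val y"
  obtains q where "q \<in> nonzero K" "val q = 0" "q \<in> B" "y = q \<otimes> x" "pan y = res q \<otimes>\<^bsub>F\<^esub> pan x"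
proof -
  have ix: "inv x \<in> nonzero K"
    using assms nonzero_inv by blast
  let ?q = "y \<otimes> inv x"
  have q: "?q \<in> nonzero K" "val ?q = 0"
    using nonzero_mult[OF assms(2) ix] val_mult[OF assms(2) ix] val_inv[OF assms(1)] assms(3)
    by auto
  have y: "y = ?q \<otimes> x"
    using assms ix field_Units by (simp add: m_assoc)
  show ?thesis
    using that[OF q B_if_val_zero[OF q] y] pan_unit_mult[OF q assms(1)] y by simp
qed

text \<open>The quotient has residue one, so it lies in \<open>A\<close> and is a strict unit. The
  square root has to be found in \<open>A\<close> rather than merely in \<open>K\<close>, because
  modules over \<open>A\<close> absorb only squares of elements of \<open>A\<close>.\<close>

lemma equal_component_imp_square_multiple:
  assumes x: "x \<in> nonzero K" and y: "y \<in> nonzero K" and eq: "val x = val y" "pan x = pan y"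
  obtains t where "t \<in> A" "y = t \<otimes> t \<otimes> x"
proof -
  obtain q where q: "q \<in> B" "y = q \<otimes> x" "pan y = res q \<otimes>\<^bsub>F\<^esub> pan x"
    using quotient_of_equal_val[OF x y eq(1)] by blast
  have "res q \<otimes>\<^bsub>F\<^esub> pan x = \<one>\<^bsub>F\<^esub> \<otimes>\<^bsub>F\<^esub> pan x"
    using q eq(2) pan_closed[OF x] by simp
  then have one: "res q = \<one>\<^bsub>F\<^esub>"
    using F.m_rcancel[of "pan x" "res q" "\<one>\<^bsub>F\<^esub>"] pan_closed[OF x] res_closed[OF q(1)] by simp
  then have "q \<in> A"
    using mem_A_iff[OF q(1)] res_one imageI[OF subringE(3)[OF subring_A], of res] by simp
  then have "strict_unit K A \<mm> q"
    using one by (simp add: strict_unit_def residue_map_A one_F0)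
  then show ?thesis
    using strict_unit_square that q(2) unfolding admits_square_root_def by blast
qed

text \<open>Writing \<open>y = q \<otimes> x\<close> gives
  \<open>x \<oplus> y = (\<one> \<oplus> q) \<otimes> x\<close>. Cancellation of the components says
  that \<open>\<one> \<oplus> q\<close> has residue zero, hence positive value.\<close>

lemma val_add_cancel:
  assumes x: "x \<in> nonzero K" and y: "y \<in> nonzero K" and eq: "val x = val y"
    and zero: "pan x \<oplus>\<^bsub>F\<^esub> pan y = \<zero>\<^bsub>F\<^esub>" and ne: "x \<oplus> y \<noteq> \<zero>"
  shows "val x < val (x \<oplus> y)"
proof -
  obtain q where q: "q \<in> nonzero K" "q \<in> B" "y = q \<otimes> x" "pan y = res q \<otimes>\<^bsub>F\<^esub> pan x"
    using quotient_of_equal_val[OF x y eq] by blast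
  have B: "\<one> \<in> B" "\<one> \<oplus> q \<in> B"
    using subringE(3,7)[OF subring_B] q by auto
  have "res (\<one> \<oplus> q) \<otimes>\<^bsub>F\<^esub> pan x = \<zero>\<^bsub>F\<^esub>"
    using zero q B pan_closed[OF x] by (simp add: res_add res_one F.l_distr)
  then have m: "\<one> \<oplus> q \<in> \<mm>"
    using F.integral[of "res (\<one> \<oplus> q)" "pan x"] pan_closed[OF x] B res_eq_zero by auto
  have xy: "x \<oplus> y = (\<one> \<oplus> q) \<otimes> x"
    using q x by (simp add: l_distr)
  then have "\<one> \<oplus> q \<in> nonzero K"
    using ne x q by auto
  then show ?thesis
    using m xy val_mult[of "\<one> \<oplus> q" x] x by (simp add: maximal_ideal_iff)
qed

text \<open>The addition axiom presupposes a nonzero sum. Here this is automatic: a zero sum would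
  mean \<open>y = \<ominus> x\<close>, whose component is the negative of that of
  \<open>x\<close>.\<close>

lemma pan_add_eq:
  assumes "x \<in> nonzero K" "y \<in> nonzero K" "val x = val y" "pan x \<oplus>\<^bsub>F\<^esub> pan y \<noteq> \<zero>\<^bsub>F\<^esub>"
  shows "x \<oplus> y \<in> nonzero K \<and> val (x \<oplus> y) = val x \<and> pan (x \<oplus> y) = pan x \<oplus>\<^bsub>F\<^esub> pan y"
proof -
  have "x \<oplus> y \<noteq> \<zero>"
  proof
    assume "x \<oplus> y = \<zero>"
    then have "y \<oplus> x = \<zero>"
      using assms by (simp add: a_comm)
    then have "y = \<ominus> x"
      using assms minus_equality[of y x] by simp
    then show False
      using assms pan_minus[of x] pan_closed[of x] F.r_neg by auto
  qed
  then show ?thesis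
    using pan_props(5) assms by simp
qed

section \<open>Quasi-quadratic modules and their components\<close>

abbreviation modules_A :: "'a set set" where
  "modules_A \<equiv> quasi_quadratic_modules (subring_of K A) (ring_as_module (subring_of K A))"

abbreviation modules_F0 :: "'a set set set" where
  "modules_F0 \<equiv> quasi_quadratic_modules F\<^sub>0 (ring_as_module F)"

abbreviation component :: "'a set \<Rightarrow> 'g \<Rightarrow> 'a set set" where
  "component M g \<equiv> value_component K B \<mm> val pan g M"

lemma modules_A_iff:
  "M \<in> modules_A \<longleftrightarrow> M \<subseteq> A \<and> \<zero> \<in> M \<and> (\<forall>x\<in>M. \<forall>y\<in>M. x \<oplus> y \<in> M) \<and>
     (\<forall>a\<in>A. \<forall>x\<in>M. a \<otimes> a \<otimes> x \<in> M)"
  by (simp add: quasi_quadratic_modules_def ring_as_module_def)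

text \<open>Scalars from the smaller residue field are represented by lifts in \<open>A\<close>, so
  that stability can be checked by multiplying in \<open>K\<close>.\<close>

lemma modules_F0_iff:
  "N \<in> modules_F0 \<longleftrightarrow> N \<subseteq> carrier F \<and> \<zero>\<^bsub>F\<^esub> \<in> N \<and> (\<forall>x\<in>N. \<forall>y\<in>N. x \<oplus>\<^bsub>F\<^esub> y \<in> N) \<and>
     (\<forall>a\<in>A. \<forall>x\<in>N. res a \<otimes>\<^bsub>F\<^esub> res a \<otimes>\<^bsub>F\<^esub> x \<in> N)"
  by (simp add: quasi_quadratic_modules_def ring_as_module_def carrier_F0 mult_F0)

text \<open>\<open>N\<close> is stable only under squares from the smaller residue field, so it
  cannot serve as a competitor for the hull. The set \<open>?T\<close> of all elements whose
  multiples by squares from \<open>F\<close> lie in \<open>N\<close> can: it is a module over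
  \<open>F\<close> containing \<open>S\<close>. Scaling by one shows
  \<open>?T \<subseteq> N\<close>.\<close>

lemma qq_closure_subset:
  assumes N: "N \<in> modules_F0" and "S \<subseteq> carrier F"
    and "\<And>c s. c \<in> carrier F \<Longrightarrow> s \<in> S \<Longrightarrow> c \<otimes>\<^bsub>F\<^esub> c \<otimes>\<^bsub>F\<^esub> s \<in> N"
  shows "qq_closure F S \<subseteq> N"
proof -
  let ?T = "{y \<in> carrier F. \<forall>c\<in>carrier F. c \<otimes>\<^bsub>F\<^esub> c \<otimes>\<^bsub>F\<^esub> y \<in> N}"
  have "c \<otimes>\<^bsub>F\<^esub> c \<otimes>\<^bsub>F\<^esub> (a \<otimes>\<^bsub>F\<^esub> a \<otimes>\<^bsub>F\<^esub> y) \<in> N"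
    if "c \<in> carrier F" "a \<in> carrier F" "y \<in> ?T" for a c y
  proof -
    have "c \<otimes>\<^bsub>F\<^esub> c \<otimes>\<^bsub>F\<^esub> (a \<otimes>\<^bsub>F\<^esub> a \<otimes>\<^bsub>F\<^esub> y) = (c \<otimes>\<^bsub>F\<^esub> a) \<otimes>\<^bsub>F\<^esub> (c \<otimes>\<^bsub>F\<^esub> a) \<otimes>\<^bsub>F\<^esub> y"
      using that by (simp add: F.m_ac)
    then show ?thesis
      using that by simp
  qed
  then have "?T \<in> quasi_quadratic_modules F (ring_as_module F)"
    using N by (auto simp: quasi_quadratic_modules_def ring_as_module_def F.r_distr)
  then have "qq_closure F S \<subseteq> ?T"
    unfolding qq_closure_def by (intro hull_minimal) (use assms in auto)
  moreover have "?T \<subseteq> N"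
  proof
    fix y assume "y \<in> ?T"
    then have "y \<in> carrier F" "\<one>\<^bsub>F\<^esub> \<otimes>\<^bsub>F\<^esub> \<one>\<^bsub>F\<^esub> \<otimes>\<^bsub>F\<^esub> y \<in> N"
      by blast+
    then show "y \<in> N"
      by simp
  qed
  ultimately show ?thesis
    by blast
qed

lemma square_multiple_in_qq_closure:
  "c \<in> carrier F \<Longrightarrow> s \<in> S \<Longrightarrow> c \<otimes>\<^bsub>F\<^esub> c \<otimes>\<^bsub>F\<^esub> s \<in> qq_closure F S"
  by (auto simp: qq_closure_def hull_def quasi_quadratic_modules_def ring_as_module_def)

lemma component_iff:
  "c \<in> component M g \<longleftrightarrow> c = \<zero>\<^bsub>F\<^esub> \<or> (\<exists>x\<in>M. x \<noteq> \<zero> \<and> val x = g \<and> c = pan x)"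
  by (auto simp: value_component_def)

lemma module_nonzero: "M \<in> modules_A \<Longrightarrow> x \<in> M \<Longrightarrow> x \<noteq> \<zero> \<Longrightarrow> x \<in> nonzero K"
  using A_carrier by (auto simp: modules_A_iff)

text \<open>A module is recovered from its components, which is the source of injectivity.\<close>

lemma mem_iff_pan_in_component:
  assumes M: "M \<in> modules_A" and x: "x \<in> nonzero K"
  shows "x \<in> M \<longleftrightarrow> pan x \<in> component M (val x)"
proof
  assume "pan x \<in> component M (val x)"
  then obtain y where y: "y \<in> M" "y \<noteq> \<zero>" "val y = val x" "pan y = pan x"
    using pan_closed[OF x] by (auto simp: component_iff)
  then obtain t where "t \<in> A" "x = t \<otimes> t \<otimes> y"
    using equal_component_imp_square_multiple[OF module_nonzero[OF M] x] by metis
  then show "x \<in> M"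
    using M y by (auto simp: modules_A_iff)
qed (use x in \<open>auto simp: component_iff\<close>)

text \<open>A sum of components that is nonzero is the component of the sum; a zero sum is harmless
  because components contain zero by definition. A nonzero scalar lifts to some \<open>a\<close> of
  value 0, and multiplying by \<open>a \<otimes> a\<close> does not change the value.\<close>

lemma component_in_modules_F0:
  assumes M: "M \<in> modules_A"
  shows "component M g \<in> modules_F0"
  unfolding modules_F0_iff
proof (intro conjI ballI)
  show "component M g \<subseteq> carrier F"
    using pan_closed module_nonzero[OF M] by (fastforce simp: component_iff)
  show "\<zero>\<^bsub>F\<^esub> \<in> component M g"
    by (simp add: component_iff)
next
  fix c d assume cd: "c \<in> component M g" "d \<in> component M g"
  show "c \<oplus>\<^bsub>F\<^esub> d \<in> component M g"
  proof (cases "c = \<zero>\<^bsub>F\<^esub> \<or> d = \<zero>\<^bsub>F\<^esub> \<or> c \<oplus>\<^bsub>F\<^esub> d = \<zero>\<^bsub>F\<^esub>")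
    case True
    then show ?thesis
      using cd pan_closed module_nonzero[OF M] by (fastforce simp: component_iff)
  next
    case False
    then obtain x y where xy: "x \<in> M" "y \<in> M" "x \<in> nonzero K" "y \<in> nonzero K"
      "val x = g" "val y = g" "c = pan x" "d = pan y"
      using cd module_nonzero[OF M] unfolding component_iff by metis
    have "x \<oplus> y \<in> M"
      using M xy by (simp add: modules_A_iff)
    then show ?thesis
      using pan_add_eq[OF xy(3,4)] xy False unfolding component_iff by auto
  qed
next
  fix a c assume a: "a \<in> A" and c: "c \<in> component M g"
  then have aB: "a \<in> B"
    using A_subset_B by blast
  show "res a \<otimes>\<^bsub>F\<^esub> res a \<otimes>\<^bsub>F\<^esub> c \<in> component M g"
  proof (cases "c = \<zero>\<^bsub>F\<^esub> \<or> a \<in> \<mm>")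
    case True
    moreover have "c \<in> carrier F"
      using c pan_closed module_nonzero[OF M] by (fastforce simp: component_iff)
    ultimately show ?thesis
      using aB res_eq_zero[OF aB] by (auto simp: component_iff)
  next
    case False
    then obtain x where x: "x \<in> M" "x \<in> nonzero K" "val x = g" "c = pan x"
      using c module_nonzero[OF M] unfolding component_iff by metis
    have a0: "a \<in> nonzero K" "val a = 0"
      using False aB by (force simp: B_iff maximal_ideal_iff)+
    have aa: "a \<otimes> a \<in> nonzero K" "val (a \<otimes> a) = 0"
      using nonzero_mult val_mult a0 by auto
    have "a \<otimes> a \<otimes> x \<in> M"
      using M a x by (simp add: modules_A_iff)
    moreover have "val (a \<otimes> a \<otimes> x) = g" "a \<otimes> a \<otimes> x \<noteq> \<zero>"
      using val_mult[OF aa(1) x(2)] nonzero_mult[OF aa(1) x(2)] aa x by auto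
    ultimately show ?thesis
      using pan_unit_mult[OF aa x(2)] res_mult[OF aB aB] x(4) unfolding component_iff by auto
  qed
qed

section \<open>Conditions (i) to (iii) for the components of a module\<close>

lemma square_scaling:
  assumes x: "x \<in> nonzero K" and c: "c \<in> nonzero F"
  obtains v where "v \<in> nonzero K" "val v = k" "pan (v \<otimes> v \<otimes> x) = c \<otimes>\<^bsub>F\<^esub> c \<otimes>\<^bsub>F\<^esub> pan x"
proof -
  obtain w where w: "w \<in> nonzero K" "val w = k" "pan w = c"
    by (rule pan_surj[OF c])
  \<comment> \<open>The axiom on squares does not say which \<open>d\<close> occurs. Multiplying
    \<open>w\<close> by a unit \<open>b\<close> of \<open>B\<close> whose residue is
    \<open>c\<close> divided by \<open>d\<close> keeps the value and turns the factor into the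
    square of \<open>c\<close>.\<close>
  obtain d where d: "d \<in> nonzero F" "pan (x \<otimes> (w \<otimes> w)) = pan x \<otimes>\<^bsub>F\<^esub> (d \<otimes>\<^bsub>F\<^esub> d)"
    by (rule pan_square[OF x w(1)])
  have di: "inv\<^bsub>F\<^esub> d \<in> carrier F" "inv\<^bsub>F\<^esub> d \<otimes>\<^bsub>F\<^esub> d = \<one>\<^bsub>F\<^esub>"
    using d F.field_Units by auto
  then have "c \<otimes>\<^bsub>F\<^esub> inv\<^bsub>F\<^esub> d \<in> carrier F"
    using c by simp
  then obtain b where b: "b \<in> B" "res b = c \<otimes>\<^bsub>F\<^esub> inv\<^bsub>F\<^esub> d"
    unfolding carrier_F by (metis imageE)
  have bd: "c = res b \<otimes>\<^bsub>F\<^esub> d"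
    using b c d di by (simp add: F.m_assoc)
  then have "b \<notin> \<mm>"
    using c d b res_eq_zero[OF b(1)] by auto
  then have b0: "b \<in> nonzero K" "val b = 0"
    using b by (force simp: B_iff maximal_ideal_iff)+
  have v: "b \<otimes> w \<in> nonzero K" "val (b \<otimes> w) = k"
    using nonzero_mult[OF b0(1) w(1)] val_mult[OF b0(1) w(1)] w b0 by auto
  have bb: "b \<otimes> b \<in> nonzero K" "val (b \<otimes> b) = 0"
    using nonzero_mult val_mult b0 by auto
  have xww: "x \<otimes> (w \<otimes> w) \<in> nonzero K"
    using nonzero_mult x w by blast
  have "(b \<otimes> w) \<otimes> (b \<otimes> w) \<otimes> x = (b \<otimes> b) \<otimes> (x \<otimes> (w \<otimes> w))"
    using b0 w x by (simp add: m_ac)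
  then have "pan ((b \<otimes> w) \<otimes> (b \<otimes> w) \<otimes> x)
      = (res b \<otimes>\<^bsub>F\<^esub> res b) \<otimes>\<^bsub>F\<^esub> (pan x \<otimes>\<^bsub>F\<^esub> (d \<otimes>\<^bsub>F\<^esub> d))"
    using pan_unit_mult[OF bb xww] d(2) res_mult[OF b(1) b(1)] by simp
  also have "\<dots> = (res b \<otimes>\<^bsub>F\<^esub> d) \<otimes>\<^bsub>F\<^esub> (res b \<otimes>\<^bsub>F\<^esub> d) \<otimes>\<^bsub>F\<^esub> pan x"
    using pan_closed[OF x] res_closed[OF b(1)] d(1) by (simp add: F.m_ac)
  finally have "pan ((b \<otimes> w) \<otimes> (b \<otimes> w) \<otimes> x) = c \<otimes>\<^bsub>F\<^esub> c \<otimes>\<^bsub>F\<^esub> pan x"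
    unfolding bd[symmetric] .
  then show ?thesis
    using that v by blast
qed

text \<open>At a strictly larger value of the same square class all scalars of \<open>F\<close>
  become available: the multiplier \<open>v\<close> from \<open>square_scaling\<close> has half the
  difference of the values as its value, which is positive, so \<open>v\<close> lies in
  \<open>A\<close> whatever \<open>c\<close> is.\<close>

lemma component_closure:
  assumes M: "M \<in> modules_A" and "g < h" "square_class g = square_class h"
  shows "qq_closure F (component M g) \<subseteq> component M h"
proof (rule qq_closure_subset[OF component_in_modules_F0[OF M]])
  show sub: "component M g \<subseteq> carrier F"
    using component_in_modules_F0[OF M] by (simp add: modules_F0_iff)
  fix c s assume c: "c \<in> carrier F" and s: "s \<in> component M g"
  show "c \<otimes>\<^bsub>F\<^esub> c \<otimes>\<^bsub>F\<^esub> s \<in> component M h"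
  proof (cases "c = \<zero>\<^bsub>F\<^esub> \<or> s = \<zero>\<^bsub>F\<^esub>")
    case True
    then have "c \<otimes>\<^bsub>F\<^esub> c \<otimes>\<^bsub>F\<^esub> s = \<zero>\<^bsub>F\<^esub>"
      using c s sub by auto
    then show ?thesis
      by (simp add: component_iff)
  next
    case False
    then obtain x where x: "x \<in> M" "x \<in> nonzero K" "val x = g" "s = pan x"
      using s module_nonzero[OF M] unfolding component_iff by metis
    obtain k where k: "h = g + (k + k)" "0 < k"
      using square_class_eq_obtains assms by blast
    obtain v where v: "v \<in> nonzero K" "val v = k" "pan (v \<otimes> v \<otimes> x) = c \<otimes>\<^bsub>F\<^esub> c \<otimes>\<^bsub>F\<^esub> pan x"
      using square_scaling[OF x(2), of c k] c False by blast
    have "v \<otimes> v \<otimes> x \<in> M"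
      using M A_if_val_pos v k x by (simp add: modules_A_iff)
    moreover have "v \<otimes> v \<otimes> x \<noteq> \<zero>" "val (v \<otimes> v \<otimes> x) = h"
      using val_mult[OF nonzero_mult[OF v(1) v(1)] x(2)] val_mult[OF v(1) v(1)]
        nonzero_mult[OF nonzero_mult[OF v(1) v(1)] x(2)] v x k by (auto simp: add.commute)
    ultimately show ?thesis
      using v(3) x(4) unfolding component_iff by metis
  qed
qed

lemma module_multiples:
  assumes M: "M \<in> modules_A" and x: "x \<in> M" "\<ominus> x \<in> M" and z: "z \<in> A"
  shows "z \<otimes> x \<in> M"
proof -
  \<comment> \<open>Here \<open>r\<close> is one half, and \<open>?q\<close> below is half of
    \<open>z\<close> minus one.\<close>
  obtain r where r: "r \<in> A" "(\<one> \<oplus> \<one>) \<otimes> r = \<one>"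
    using two_unit by (auto simp: Units_def)
  let ?q = "r \<otimes> (z \<oplus> \<ominus> \<one>)"
  have A: "?q \<in> A" "?q \<oplus> \<one> \<in> A"
    using subringE(3,5,6,7)[OF subring_A] r z by auto
  have cl: "r \<in> carrier K" "z \<in> carrier K" "x \<in> carrier K" "?q \<in> carrier K"
    using A_carrier r z x M A by (auto simp: modules_A_iff)
  have "?q \<oplus> ?q = ((\<one> \<oplus> \<one>) \<otimes> r) \<otimes> (z \<oplus> \<ominus> \<one>)"
    using cl by (simp add: l_distr m_assoc)
  then have q: "?q \<oplus> ?q \<oplus> \<one> = z"
    using r cl by (simp add: a_assoc l_neg)
  define q where "q = ?q"
  have qc: "q \<in> carrier K" and qz: "q \<oplus> q \<oplus> \<one> = z"
    using cl q by (simp_all add: q_def)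
  \<comment> \<open>A square times \<open>x\<close> plus a square times \<open>\<ominus> x\<close>.
    The terms in \<open>q \<otimes> q\<close> cancel, and what remains has the coefficient
    \<open>q \<oplus> q \<oplus> \<one> = z\<close>.\<close>
  have "(q \<oplus> \<one>) \<otimes> (q \<oplus> \<one>) \<otimes> x \<oplus> q \<otimes> q \<otimes> (\<ominus> x)
      = (q \<oplus> q \<oplus> \<one>) \<otimes> x \<oplus> (q \<otimes> q \<otimes> x \<oplus> \<ominus> (q \<otimes> q \<otimes> x))"
    using qc cl(3) by (simp add: l_distr r_distr r_minus a_ac)
  also have "\<dots> = z \<otimes> x"
    using qz qc cl by (simp add: r_neg)
  finally show ?thesis
    using M A x unfolding q_def[symmetric] modules_A_iff by metis
qed

text \<open>A witness \<open>x\<close> for \<open>u\<close> lies in \<open>M\<close> together with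
  its negative. Any \<open>w\<close> of value \<open>h\<close> is \<open>x\<close> times an element
  of positive value, hence of \<open>A\<close>, so \<open>module_multiples\<close> puts
  \<open>w\<close> into \<open>M\<close>.\<close>

lemma component_eq_carrier:
  assumes M: "M \<in> modules_A" and "g < h" and u: "u \<in> nonzero F" "u \<in> component M g" "\<ominus>\<^bsub>F\<^esub> u \<in> component M g"
  shows "component M h = carrier F"
proof
  show "component M h \<subseteq> carrier F"
    using component_in_modules_F0[OF M] by (simp add: modules_F0_iff)
  obtain x where x: "x \<in> M" "x \<in> nonzero K" "val x = g" "u = pan x"
    using u module_nonzero[OF M] unfolding component_iff by blast
  have mx: "\<ominus> x \<in> M"
    using mem_iff_pan_in_component[OF M nonzero_minus[OF x(2)]] u(3) x
    by (simp add: pan_minus val_minus)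
  have ix: "inv x \<in> nonzero K"
    using nonzero_inv x by blast
  show "carrier F \<subseteq> component M h"
  proof
    fix c assume c: "c \<in> carrier F"
    show "c \<in> component M h"
    proof (cases "c = \<zero>\<^bsub>F\<^esub>")
      case False
      with c have "c \<in> nonzero F"
        by simp
      then obtain w where w: "w \<in> nonzero K" "val w = h" "pan w = c"
        by (rule pan_surj)
      have "w \<otimes> inv x \<in> A"
        using A_if_val_pos nonzero_mult[OF w(1) ix] val_mult[OF w(1) ix] val_inv[OF x(2)]
          w x \<open>g < h\<close> by simp
      then have "w \<otimes> inv x \<otimes> x \<in> M"
        using module_multiples[OF M x(1) mx] by blast
      then have "w \<in> M"
        using w x ix field_Units by (simp add: m_assoc)
      then show ?thesis
        using w unfolding component_iff by auto
    qed (simp add: component_iff)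
  qed
qed

lemma component_family_in_families:
  assumes M: "M \<in> modules_A"
  shows "component_family K B \<mm> val pan M \<in> qq_families F\<^sub>0 F"
proof -
  \<comment> \<open>Condition (i): an element of value 0 has its residue as its component, and
    elements of \<open>M\<close> lie in \<open>A\<close>.\<close>
  have "component M 0 \<subseteq> carrier F\<^sub>0"
  proof
    fix c assume c: "c \<in> component M 0"
    show "c \<in> carrier F\<^sub>0"
    proof (cases "c = \<zero>\<^bsub>F\<^esub>")
      case True
      have "res \<zero> = \<zero>\<^bsub>F\<^esub>" "\<zero> \<in> A"
        using res_eq_zero[of \<zero>] subringE(2)[OF subring_A] by (auto simp: B_iff maximal_ideal_iff)
      then show ?thesis
        using True unfolding carrier_F0 by force
    next
      case False
      then obtain x where x: "x \<in> M" "x \<in> nonzero K" "val x = 0" "c = pan x"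
        using c module_nonzero[OF M] unfolding component_iff by blast
      then show ?thesis
        using M pan_unit unfolding carrier_F0 modules_A_iff by blast
    qed
  qed
  show ?thesis
    unfolding qq_families_def component_family_def
  proof (intro CollectI conjI allI impI)
    show "(\<lambda>g\<in>{0..}. component M g) \<in> {0..} \<rightarrow>\<^sub>E modules_F0"
      using component_in_modules_F0[OF M] by simp
    show "(\<lambda>g\<in>{0..}. component M g) 0 \<subseteq> carrier F\<^sub>0"
      using \<open>component M 0 \<subseteq> carrier F\<^sub>0\<close> by simp
  next
    fix g h :: 'g
    assume "0 \<le> g \<and> g < h \<and> square_class g = square_class h"
    \<comment> \<open>The restricted family is \<open>undefined\<close> at negative values, so the
      sign of \<open>h\<close> must be settled before it can be evaluated.\<close>
    moreover from this have "0 \<le> h"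
      by auto
    ultimately show "qq_closure F ((\<lambda>g\<in>{0..}. component M g) g) \<subseteq> (\<lambda>g\<in>{0..}. component M g) h"
      using component_closure[OF M, of g h] by simp
  next
    fix h :: 'g
    assume "\<exists>g u. 0 \<le> g \<and> g < h \<and> u \<in> nonzero F \<and> u \<in> (\<lambda>g\<in>{0..}. component M g) g \<and>
      \<ominus>\<^bsub>F\<^esub> u \<in> (\<lambda>g\<in>{0..}. component M g) g"
    then obtain g u where g: "0 \<le> g" "g < h" and u: "u \<in> nonzero F"
      "u \<in> (\<lambda>g\<in>{0..}. component M g) g" "\<ominus>\<^bsub>F\<^esub> u \<in> (\<lambda>g\<in>{0..}. component M g) g"
      by blast
    moreover have "0 \<le> h"
      using g by simp
    ultimately show "(\<lambda>g\<in>{0..}. component M g) h = carrier F"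
      using component_eq_carrier[OF M g(2) u(1)] by simp
  qed
qed

section \<open>The inverse map\<close>

definition module_of_family :: "('g \<Rightarrow> 'a set set) \<Rightarrow> 'a set" where
  "module_of_family N = {x \<in> carrier K. x = \<zero> \<or> 0 \<le> val x \<and> pan x \<in> N (val x)}"

lemma qq_familiesD:
  assumes "N \<in> qq_families F\<^sub>0 F"
  shows "N \<in> {0..} \<rightarrow>\<^sub>E modules_F0"
    and "N 0 \<subseteq> carrier F\<^sub>0"
    and "\<lbrakk>0 \<le> g; g < h; square_class g = square_class h\<rbrakk> \<Longrightarrow> qq_closure F (N g) \<subseteq> N h"
    and "\<lbrakk>0 \<le> g; g < h; u \<in> nonzero F; u \<in> N g; \<ominus>\<^bsub>F\<^esub> u \<in> N g\<rbrakk> \<Longrightarrow> N h = carrier F"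
proof -
  note N = assms[unfolded qq_families_def mem_Collect_eq]
  show "N \<in> {0..} \<rightarrow>\<^sub>E modules_F0" "N 0 \<subseteq> carrier F\<^sub>0"
    by (rule N[THEN conjunct1], rule N[THEN conjunct2, THEN conjunct1])
  show "qq_closure F (N g) \<subseteq> N h" if "0 \<le> g" "g < h" "square_class g = square_class h"
    using N[THEN conjunct2, THEN conjunct2, THEN conjunct1] that by blast
  show "N h = carrier F" if "0 \<le> g" "g < h" "u \<in> nonzero F" "u \<in> N g" "\<ominus>\<^bsub>F\<^esub> u \<in> N g"
    using N[THEN conjunct2, THEN conjunct2, THEN conjunct2] that by blast
qed

text \<open>Each condition on families serves one step: (i) gives containment in \<open>A\<close> at
  value 0, (ii) gives stability under squares of elements of positive value, and (iii) gives sums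
  whose leading components cancel. The remaining cases use that each \<open>N g\<close> is a
  quasi-quadratic module.\<close>

lemma module_of_family_in_modules:
  assumes N: "N \<in> qq_families F\<^sub>0 F"
  shows "module_of_family N \<in> modules_A"
  unfolding modules_A_iff
proof (intro conjI ballI)
  have mod: "N g \<in> modules_F0" if "0 \<le> g" for g
    using PiE_mem[OF qq_familiesD(1)[OF N]] that by simp
  have N0: "N 0 \<subseteq> res ` A"
    using qq_familiesD(2)[OF N] by (simp only: carrier_F0)
  note closure = qq_familiesD(3)[OF N] and full = qq_familiesD(4)[OF N]
  show sub: "module_of_family N \<subseteq> A"
  proof
    fix x assume x: "x \<in> module_of_family N"
    show "x \<in> A"
    proof (cases "x = \<zero> \<or> 0 < val x")
      case True
      then show ?thesis
        using x A_if_val_pos subringE(2)[OF subring_A] by (auto simp: module_of_family_def)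
    next
      case False
      then have "x \<in> nonzero K" "val x = 0" "pan x \<in> N 0"
        using x by (auto simp: module_of_family_def order_le_less)
      then show ?thesis
        using mem_A_iff[OF B_if_val_zero] pan_unit N0 by auto
    qed
  qed
  show "\<zero> \<in> module_of_family N"
    by (simp add: module_of_family_def)
  fix x assume x: "x \<in> module_of_family N"
  {
    fix y assume y: "y \<in> module_of_family N"
    show "x \<oplus> y \<in> module_of_family N"
    proof (cases "x = \<zero> \<or> y = \<zero> \<or> x \<oplus> y = \<zero>")
      case True
      then show ?thesis
        using x y by (auto simp: module_of_family_def)
    next
      case False
      then have xy: "x \<in> nonzero K" "y \<in> nonzero K" "x \<oplus> y \<in> nonzero K" "0 \<le> val x" "0 \<le> val y"
        "pan x \<in> N (val x)" "pan y \<in> N (val y)"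
        using x y by (auto simp: module_of_family_def)
      consider "val x < val y" | "val y < val x"
        | "val x = val y" "pan x \<oplus>\<^bsub>F\<^esub> pan y \<noteq> \<zero>\<^bsub>F\<^esub>"
        | "val x = val y" "pan x \<oplus>\<^bsub>F\<^esub> pan y = \<zero>\<^bsub>F\<^esub>"
        using linorder_less_linear[of "val x" "val y"] by blast
      then have "0 \<le> val (x \<oplus> y) \<and> pan (x \<oplus> y) \<in> N (val (x \<oplus> y))"
      proof cases
        case 1
        then show ?thesis
          using val_add_less[OF xy(1,2)] pan_add_less[OF xy(1,2)] xy by simp
      next
        case 2
        then show ?thesis
          using val_add_less[OF xy(2,1)] pan_add_less[OF xy(2,1)] xy a_comm[of x y] by simp
      next
        case 3
        then show ?thesis
          using pan_add_eq[OF xy(1,2)] mod[OF xy(4)] xy by (simp add: modules_F0_iff)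
      next
        case 4
        \<comment> \<open>Cancellation means that \<open>N\<close> contains a nonzero element and
          its negative at \<open>val x\<close>. The sum has strictly larger value, where condition
          (iii) leaves no restriction on its component.\<close>
        have "pan y \<oplus>\<^bsub>F\<^esub> pan x = \<zero>\<^bsub>F\<^esub>"
          using 4 xy pan_closed by (simp add: F.a_comm)
        then have "\<ominus>\<^bsub>F\<^esub> pan x = pan y"
          using xy pan_closed by (simp add: F.minus_equality)
        then have "N (val (x \<oplus> y)) = carrier F"
          using full[OF xy(4) val_add_cancel[OF xy(1,2) 4] pan_closed[OF xy(1)] xy(6)] xy 4 by simp
        then show ?thesis
          using val_add_cancel[OF xy(1,2) 4] xy pan_closed[OF xy(3)] by simp
      qed
      then show ?thesis
        using xy by (simp add: module_of_family_def)
    qed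
  next
    fix a assume a: "a \<in> A"
    show "a \<otimes> a \<otimes> x \<in> module_of_family N"
    proof (cases "a = \<zero> \<or> x = \<zero>")
      case True
      then show ?thesis
        using a A_carrier x by (auto simp: module_of_family_def)
    next
      case False
      then have xa: "x \<in> nonzero K" "a \<in> nonzero K" "0 \<le> val x" "pan x \<in> N (val x)" "0 \<le> val a"
        using x a A_carrier val_nonneg by (auto simp: module_of_family_def)
      have aa: "a \<otimes> a \<in> nonzero K" "val (a \<otimes> a) = val a + val a"
        using nonzero_mult val_mult xa by auto
      have aax: "a \<otimes> a \<otimes> x \<in> nonzero K" "val (a \<otimes> a \<otimes> x) = val x + (val a + val a)"
        using nonzero_mult[OF aa(1) xa(1)] val_mult[OF aa(1) xa(1)] aa by (auto simp: add.commute)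
      have "pan (a \<otimes> a \<otimes> x) \<in> N (val (a \<otimes> a \<otimes> x))"
      proof (cases "val a = 0")
        case True
        have "a \<in> B"
          using a A_subset_B by blast
        then have "pan (a \<otimes> a \<otimes> x) = res a \<otimes>\<^bsub>F\<^esub> res a \<otimes>\<^bsub>F\<^esub> pan x"
          using pan_unit_mult[OF aa(1) _ xa(1)] aa True res_mult by simp
        then show ?thesis
          using mod[OF xa(3)] xa a aax True by (simp add: modules_F0_iff)
      next
        case False
        \<comment> \<open>Now \<open>val a\<close> is positive. The factor \<open>k\<close> may be
          any nonzero element of \<open>F\<close>, which is why condition (ii) is about the closure
          over \<open>F\<close>.\<close>
        obtain k where k: "k \<in> nonzero F" "pan (x \<otimes> (a \<otimes> a)) = pan x \<otimes>\<^bsub>F\<^esub> (k \<otimes>\<^bsub>F\<^esub> k)"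
          by (rule pan_square[OF xa(1,2)])
        have "pan (a \<otimes> a \<otimes> x) = k \<otimes>\<^bsub>F\<^esub> k \<otimes>\<^bsub>F\<^esub> pan x"
          using k xa pan_closed[OF xa(1)] by (simp add: m_comm F.m_comm)
        moreover have "k \<otimes>\<^bsub>F\<^esub> k \<otimes>\<^bsub>F\<^esub> pan x \<in> qq_closure F (N (val x))"
          using square_multiple_in_qq_closure k xa by simp
        moreover have "val x < val (a \<otimes> a \<otimes> x)"
          using False xa aax by simp
        moreover have "square_class (val x) = square_class (val (a \<otimes> a \<otimes> x))"
          unfolding aax by (rule square_class_add_double[symmetric])
        ultimately show ?thesis
          using closure[OF xa(3)] by auto
      qed
      then show ?thesis
        using aax xa by (simp add: module_of_family_def)
    qed
  }
qed

text \<open>Every nonzero element of \<open>F\<close> is the component of some element of each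
  prescribed value, so no entry of \<open>N g\<close> is lost.\<close>

lemma component_module_of_family:
  assumes N: "N \<in> qq_families F\<^sub>0 F" and "0 \<le> g"
  shows "component (module_of_family N) g = N g"
proof -
  have "N g \<in> modules_F0"
    using PiE_mem[OF qq_familiesD(1)[OF N]] \<open>0 \<le> g\<close> by simp
  then have Ng: "N g \<subseteq> carrier F" "\<zero>\<^bsub>F\<^esub> \<in> N g"
    by (auto simp: modules_F0_iff)
  show ?thesis
  proof (intro equalityI subsetI)
    fix c assume "c \<in> component (module_of_family N) g"
    then show "c \<in> N g"
      using Ng by (auto simp: component_iff module_of_family_def)
  next
    fix c assume c: "c \<in> N g"
    show "c \<in> component (module_of_family N) g"
    proof (cases "c = \<zero>\<^bsub>F\<^esub>")
      case False
      with c Ng have "c \<in> nonzero F"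
        by auto
      then obtain w where "w \<in> nonzero K" "val w = g" "pan w = c"
        by (rule pan_surj)
      then show ?thesis
        using c \<open>0 \<le> g\<close> by (auto simp: component_iff module_of_family_def)
    qed (simp add: component_iff)
  qed
qed

lemma bij_component_family:
  "bij_betw (component_family K B \<mm> val pan) modules_A (qq_families F\<^sub>0 F)"
proof (rule bij_betwI[where g = module_of_family])
  show "component_family K B \<mm> val pan \<in> modules_A \<rightarrow> qq_families F\<^sub>0 F"
    using component_family_in_families by blast
  show "module_of_family \<in> qq_families F\<^sub>0 F \<rightarrow> modules_A"
    using module_of_family_in_modules by blast
next
  fix M assume M: "M \<in> modules_A"
  have "x \<in> module_of_family (component_family K B \<mm> val pan M) \<longleftrightarrow> x \<in> M" for x
  proof (cases "x \<in> nonzero K")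
    case True
    \<comment> \<open>Membership in \<open>module_of_family\<close> demands a nonnegative value,
      which elements of \<open>M\<close> have because they lie in \<open>A\<close>.\<close>
    have "x \<in> M \<Longrightarrow> 0 \<le> val x"
      using True M val_nonneg by (auto simp: modules_A_iff)
    then show ?thesis
      using True mem_iff_pan_in_component[OF M True]
      by (auto simp: module_of_family_def component_family_def)
  next
    case False
    have "\<zero> \<in> M" "x \<in> M \<Longrightarrow> x \<in> carrier K"
      using M A_carrier by (auto simp: modules_A_iff)
    then show ?thesis
      using False by (auto simp: module_of_family_def)
  qed
  then show "module_of_family (component_family K B \<mm> val pan M) = M"
    by blast
next
  fix N :: "'g \<Rightarrow> 'a set set" assume N: "N \<in> qq_families F\<^sub>0 F"
  \<comment> \<open>Equality of the families as functions also needs agreement at negative values,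
    where both are \<open>undefined\<close>.\<close>
  have "N g = undefined" if "\<not> 0 \<le> g" for g
    using PiE_arb[OF qq_familiesD(1)[OF N]] that by simp
  then show "component_family K B \<mm> val pan (module_of_family N) = N"
    using component_module_of_family[OF N]
    by (auto simp: component_family_def restrict_def fun_eq_iff)
qed

end

theorem theorem3p16:
  fixes K :: "('a, 'b) ring_scheme"
    and A B \<mm> :: "'a set"
    and val :: "'a \<Rightarrow> 'g::linordered_ab_group_add"
    and pan :: "'a \<Rightarrow> 'a set"
  assumes "pseudo_valuation_domain K A"
    and "maximalideal \<mm> (subring_of K A)"
    and "valuation_ring_in K B" and "A \<subseteq> B" and "maximalideal \<mm> (subring_of K B)"
    and "surj_valuation K val" and "B = ring_of_valuation K val"
    and "\<one>\<^bsub>K\<^esub> \<oplus>\<^bsub>K\<^esub> \<one>\<^bsub>K\<^esub> \<in> Units (subring_of K A)"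
    and "\<And>x. strict_unit K A \<mm> x \<Longrightarrow> admits_square_root K A x"
    and "pseudo_angular_component K B \<mm> val pan"
  shows "bij_betw (component_family K B \<mm> val pan)
           (quasi_quadratic_modules (subring_of K A) (ring_as_module (subring_of K A)))
           (qq_families (residue_ring K A \<mm>) (residue_ring K B \<mm>))"
proof -
  interpret valued_pvd K A B \<mm> val pan
    by (rule valued_pvd.intro) (fact assms)+
  show ?thesis
    by (rule bij_component_family)
qed

end
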